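(* Let $\langle v_i\rangle_{i\ge1}$ and $\langle\pi_i\rangle_{i\ge0}$ be the sequences generated by DPI or by IPI, starting from an admissible policy $\pi_0$ and under the boundary condition that, for every $i\in\mathbb N$, if $\pi_{i-1}$ is admissible then $\lim_{t\to\infty}\mathbb G_{\pi_{i-1}}^x[\gamma^tv_i(X_t)]=0$ for all $x\in\mathcal X$. Denote $\hat v_*(x)=\sup_{i\in\mathbb N}v_i(x)$ for $x\in\mathcal X$. Then $\hat v_*$ is lower semicontinuous, and $v_i\to\hat v_*$ (a) pointwise; (b) uniformly on $\Omega\subset\mathcal X$ if $\Omega$ is compact and $\hat v_*$ is continuous over $\Omega$; (c) locally uniformly if $\hat v_*$ is continuous.
   Context: State space $\mathcal X=\mathbb R^l$, $\mathcal X^{\mathsf T}=\mathbb R^{1\times l}$, time space $\mathbb T=[0,\infty)$. The action space $\mathcal U\subseteq\mathbb R^m$ is an $m$-dimensional manifold with or without boundary, meaning $\mathcal U=O\cup\partial O$ or $\mathcal U=O$ for some open $O\subseteq\mathbb R^m$. The environment is $\dot X_t=f(X_t,U_t)$, with $f:\mathcal X\times\mathcal U\to\mathcal X$ continuous and $t\mapsto U_t\in\mathcal U$ continuous; it is a standing assumption that the state trajectory $t\mapsto X_t$ is uniquely defined over all of $\mathbb T$ (for every initial state, in particular under every policy). A policy is a continuous function $\pi:\mathcal X\to\mathcal U$. $\mathbb G_\pi^x[Y]$ denotes the value of $Y$ when $X_0=x$ and $U_t=\pi(X_t)$ for all $t\in\mathbb T$. The reward function $r:\mathcal X\times\mathcal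 U\to\mathbb R$ is continuous, $R_t=r(X_t,U_t)$; $\gamma\in(0,1]$ is the discount factor and $\alpha=-\ln\gamma\ge0$. Standing assumption: $r$ attains a maximum $r_{\mathsf{max}}$, and $r_{\mathsf{max}}=0$ if $\gamma=1$. The value function (VF) of $\pi$ is $v_\pi(x)=\mathbb G_\pi^x[\int_0^\infty\gamma^tR_t\,dt]\in[-\infty,\infty)$. A policy $\pi$ is admissible iff $v_\pi(x)$ is finite for all $x\in\mathcal X$. Standing assumption: at least one admissible policy exists, and every admissible VF is $\mathrm C^1$. Gradients are row vectors, and the Hamiltonian is $h(x,u,p)=r(x,u)+p\,f(x,u)$. Standing assumption: there is a continuous $u_*:\mathcal X\times\mathcal X^{\mathsf T}\to\mathcal U$ with $u_*(x,p)\in\arg\max_{u\in\mathcal U}h(x,u,p)$ for all $(x,p)$. DPI (differential policy iteration): given an admissible policy $\pi_0$, for $i=1,2,\dots$: (evaluation) $v_i:\mathcal X\to\mathbb R$ is a $\mathrm C^1$ function with $\alpha v_i(x)=h(x,\pi_{i-1}(x),\nabla v_i(x))$ for all $x$; (improvement) $\pi_i$ is a policy with $\pi_i(x)\in\arg\max_{u\in\mathcal U}h(x,u,\nabla v_i(x))$ for all $x$. IPI (integral policy iteration): given an admissible policy $\pi_0$ and a fixed $\eta>0$, for $i=1,2,\dots$: (evaluation) $v_i:\mathcal X\to\mathbb R$ is a $\mathrm C^1$ function with $v_i(x)=\mathbb G_{\pi_{i-1}}^x[\int_0^\eta\gamma^tR_t\,dt+\gamma^\eta v_i(X_\eta)]$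 for all $x$; (improvement) $\pi_i$ is a policy with $\pi_i(x)\in\arg\max_{u\in\mathcal U}[r(x,u)+\nabla v_i(x)f_{\mathsf c}(x,u)]$ for all $x$, where $f(x,u)=f_{\mathsf d}(x)+f_{\mathsf c}(x,u)$ with $f_{\mathsf d},f_{\mathsf c}$ continuous (the same argmax set as for $h(x,\cdot,\nabla v_i(x))$). Locally uniform convergence means each $x\in\mathcal X$ has a neighborhood on which convergence is uniform. *)

theory Defs
  imports "HOL-Analysis.Analysis"
begin

text \<open>
  States are vectors in \<open>real ^ 'l\<close>, actions lie in a set \<open>U\<close> of vectors in \<open>real ^ 'm\<close>, and time
  ranges over \<open>{0..}\<close>. A row vector \<open>p\<close> is represented by its entries, as an element of
  \<open>real ^ 'l\<close>; the product of a row vector \<open>p\<close> and a column vector \<open>y\<close> is then \<open>p \<bullet> y\<close>.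
  The dynamics \<open>f x u\<close> and the reward \<open>r x u\<close> are meaningful for \<open>u \<in> U\<close> only.
\<close>

definition action_manifold :: "(real ^ 'm) set \<Rightarrow> bool" where
  "action_manifold U \<longleftrightarrow> (\<exists>W. open W \<and> (U = W \<union> frontier W \<or> U = W))"

definition policy :: "(real ^ 'm) set \<Rightarrow> (real ^ 'l \<Rightarrow> real ^ 'm) \<Rightarrow> bool" where
  "policy U \<pi> \<longleftrightarrow> continuous_on UNIV \<pi> \<and> range \<pi> \<subseteq> U"


subsection \<open>Trajectories\<close>

text \<open>
  Trajectories are functions on \<open>{0..}\<close>, extended by \<open>undefined\<close> to negative times so that they are
  unique as HOL functions. The derivative at time 0 is one-sided.
\<close>

definition trajectory ::
  "(real ^ 'l \<Rightarrow> real ^ 'm \<Rightarrow> real ^ 'l) \<Rightarrow> (real \<Rightarrow> real ^ 'm) \<Rightarrow> real ^ 'l \<Rightarrow> (real \<Rightarrow> real ^ 'l) \<Rightarrow> bool"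
where
  "trajectory f a x X \<longleftrightarrow> X \<in> extensional {0..} \<and> X 0 = x \<and>
     (\<forall>t\<ge>0. (X has_vector_derivative f (X t) (a t)) (at t within {0..}))"

definition policy_trajectory ::
  "(real ^ 'l \<Rightarrow> real ^ 'm \<Rightarrow> real ^ 'l) \<Rightarrow> (real ^ 'l \<Rightarrow> real ^ 'm) \<Rightarrow> real ^ 'l \<Rightarrow> (real \<Rightarrow> real ^ 'l) \<Rightarrow> bool"
where
  "policy_trajectory f \<pi> x X \<longleftrightarrow> trajectory f (\<lambda>t. \<pi> (X t)) x X"

definition under_policy ::
  "(real ^ 'l \<Rightarrow> real ^ 'm \<Rightarrow> real ^ 'l) \<Rightarrow> (real ^ 'l \<Rightarrow> real ^ 'm) \<Rightarrow> real ^ 'l \<Rightarrow>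
   ((real \<Rightarrow> real ^ 'l) \<Rightarrow> (real \<Rightarrow> real ^ 'm) \<Rightarrow> 'y) \<Rightarrow> 'y"
where \<comment> \<open>the value of a quantity \<open>Y\<close>, which depends on the state and action trajectories, when the
    initial state is \<open>x\<close> and the policy \<open>\<pi>\<close> is followed\<close>
  "under_policy f \<pi> x Y = (let X = (THE X. policy_trajectory f \<pi> x X) in Y X (\<lambda>t. \<pi> (X t)))"


subsection \<open>Value functions\<close>

definition discounted_reward ::
  "(real ^ 'l \<Rightarrow> real ^ 'm \<Rightarrow> real) \<Rightarrow> real \<Rightarrow> real \<Rightarrow> (real \<Rightarrow> real ^ 'l) \<Rightarrow> (real \<Rightarrow> real ^ 'm) \<Rightarrow> real"
where
  "discounted_reward r \<gamma> T X a = integral {0..T} (\<lambda>t. \<gamma> powr t * r (X t) (a t))"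

text \<open>
  The integral over \<open>{0..}\<close> is improper, with values in the extended reals. For \<open>r\<close> bounded above
  (with upper bound 0 if \<open>\<gamma> = 1\<close>) the limit always exists and is less than \<open>\<infinity>\<close>.
\<close>

definition VF ::
  "(real ^ 'l \<Rightarrow> real ^ 'm \<Rightarrow> real ^ 'l) \<Rightarrow> (real ^ 'l \<Rightarrow> real ^ 'm \<Rightarrow> real) \<Rightarrow> real \<Rightarrow>
   (real ^ 'l \<Rightarrow> real ^ 'm) \<Rightarrow> real ^ 'l \<Rightarrow> ereal"
where
  "VF f r \<gamma> \<pi> x =
     under_policy f \<pi> x (\<lambda>X a. Lim at_top (\<lambda>T. ereal (discounted_reward r \<gamma> T X a)))"

definition admissible ::
  "(real ^ 'm) set \<Rightarrow> (real ^ 'l \<Rightarrow> real ^ 'm \<Rightarrow> real ^ 'l) \<Rightarrow> (real ^ 'l \<Rightarrow> real ^ 'm \<Rightarrow> real) \<Rightarrow> real \<Rightarrow>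
   (real ^ 'l \<Rightarrow> real ^ 'm) \<Rightarrow> bool"
where
  "admissible U f r \<gamma> \<pi> \<longleftrightarrow> policy U \<pi> \<and> (\<forall>x. \<bar>VF f r \<gamma> \<pi> x\<bar> \<noteq> \<infinity>)"


subsection \<open>Gradients and the Hamiltonian\<close>

definition grad :: "(real ^ 'l \<Rightarrow> real) \<Rightarrow> real ^ 'l \<Rightarrow> real ^ 'l" where
  "grad v x = (THE p. GDERIV v x :> p)"

definition C1 :: "(real ^ 'l \<Rightarrow> real) \<Rightarrow> bool" where
  "C1 v \<longleftrightarrow> (\<forall>x. v differentiable (at x)) \<and> continuous_on UNIV (grad v)"

definition hamiltonian ::
  "(real ^ 'l \<Rightarrow> real ^ 'm \<Rightarrow> real ^ 'l) \<Rightarrow> (real ^ 'l \<Rightarrow> real ^ 'm \<Rightarrow> real) \<Rightarrow>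
   real ^ 'l \<Rightarrow> real ^ 'm \<Rightarrow> real ^ 'l \<Rightarrow> real"
where
  "hamiltonian f r x u p = r x u + p \<bullet> f x u"


subsection \<open>Standing assumptions\<close>

locale rl_problem =
  fixes U :: "(real ^ 'm) set"
    and f :: "real ^ 'l \<Rightarrow> real ^ 'm \<Rightarrow> real ^ 'l"
    and r :: "real ^ 'l \<Rightarrow> real ^ 'm \<Rightarrow> real"
    and \<gamma> :: real
  assumes action_space: "action_manifold U"
    and dynamics_continuous: "continuous_on (UNIV \<times> U) (\<lambda>(x, u). f x u)"
    and trajectory_unique:
      "\<And>a x. continuous_on {0..} a \<Longrightarrow> a ` {0..} \<subseteq> U \<Longrightarrow> \<exists>!X. trajectory f a x X"
    and policy_trajectory_unique:
      "\<And>\<pi> x. policy U \<pi> \<Longrightarrow> \<exists>!X. policy_trajectory f \<pi> x X"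
    and reward_continuous: "continuous_on (UNIV \<times> U) (\<lambda>(x, u). r x u)"
    and discount: "0 < \<gamma>" "\<gamma> \<le> 1"
    and reward_max:
      "\<exists>y. \<exists>w\<in>U. (\<forall>x. \<forall>u\<in>U. r x u \<le> r y w) \<and> (\<gamma> = 1 \<longrightarrow> r y w = 0)"
    and admissible_exists: "\<exists>\<pi>. admissible U f r \<gamma> \<pi>"
    and admissible_VF_C1:
      "\<And>\<pi>. admissible U f r \<gamma> \<pi> \<Longrightarrow> C1 (\<lambda>x. real_of_ereal (VF f r \<gamma> \<pi> x))"
    and argmax_selection:
      "\<exists>ustar. continuous_on UNIV (\<lambda>(x, p). ustar x p) \<and>
         (\<forall>x p. is_arg_max (\<lambda>u. hamiltonian f r x u p) (\<lambda>u. u \<in> U) (ustar x p))"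


subsection \<open>Policy iteration\<close>

text \<open>
  The value functions are \<open>v 1, v 2, \<dots>\<close>, while \<open>v 0\<close> is arbitrary; the policies are
  \<open>\<pi> 0, \<pi> 1, \<dots>\<close>. The constant \<open>- ln \<gamma>\<close> is the rate usually denoted by \<open>\<alpha>\<close>.
\<close>

definition DPI ::
  "(real ^ 'm) set \<Rightarrow> (real ^ 'l \<Rightarrow> real ^ 'm \<Rightarrow> real ^ 'l) \<Rightarrow> (real ^ 'l \<Rightarrow> real ^ 'm \<Rightarrow> real) \<Rightarrow> real \<Rightarrow>
   (nat \<Rightarrow> real ^ 'l \<Rightarrow> real) \<Rightarrow> (nat \<Rightarrow> real ^ 'l \<Rightarrow> real ^ 'm) \<Rightarrow> bool"
where
  "DPI U f r \<gamma> v \<pi> \<longleftrightarrow>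
     admissible U f r \<gamma> (\<pi> 0) \<and>
     (\<forall>i\<ge>1.
        C1 (v i) \<and>
        (\<forall>x. (- ln \<gamma>) * v i x = hamiltonian f r x (\<pi> (i - 1) x) (grad (v i) x)) \<and>
        policy U (\<pi> i) \<and>
        (\<forall>x. is_arg_max (\<lambda>u. hamiltonian f r x u (grad (v i) x)) (\<lambda>u. u \<in> U) (\<pi> i x)))"

definition IPI ::
  "(real ^ 'm) set \<Rightarrow> (real ^ 'l \<Rightarrow> real ^ 'm \<Rightarrow> real ^ 'l) \<Rightarrow> (real ^ 'l \<Rightarrow> real ^ 'm \<Rightarrow> real) \<Rightarrow> real \<Rightarrow>
   real \<Rightarrow> (real ^ 'l \<Rightarrow> real ^ 'l) \<Rightarrow> (real ^ 'l \<Rightarrow> real ^ 'm \<Rightarrow> real ^ 'l) \<Rightarrow>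
   (nat \<Rightarrow> real ^ 'l \<Rightarrow> real) \<Rightarrow> (nat \<Rightarrow> real ^ 'l \<Rightarrow> real ^ 'm) \<Rightarrow> bool"
where
  "IPI U f r \<gamma> \<eta> f\<^sub>d f\<^sub>c v \<pi> \<longleftrightarrow>
     \<eta> > 0 \<and>
     continuous_on UNIV f\<^sub>d \<and> continuous_on (UNIV \<times> U) (\<lambda>(x, u). f\<^sub>c x u) \<and>
     (\<forall>x. \<forall>u\<in>U. f x u = f\<^sub>d x + f\<^sub>c x u) \<and>
     admissible U f r \<gamma> (\<pi> 0) \<and>
     (\<forall>i\<ge>1.
        C1 (v i) \<and>
        (\<forall>x. v i x = under_policy f (\<pi> (i - 1)) x
               (\<lambda>X a. discounted_reward r \<gamma> \<eta> X a + \<gamma> powr \<eta> * v i (X \<eta>))) \<and>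
        policy U (\<pi> i) \<and>
        (\<forall>x. is_arg_max (\<lambda>u. r x u + grad (v i) x \<bullet> f\<^sub>c x u) (\<lambda>u. u \<in> U) (\<pi> i x)))"

definition boundary_condition ::
  "(real ^ 'm) set \<Rightarrow> (real ^ 'l \<Rightarrow> real ^ 'm \<Rightarrow> real ^ 'l) \<Rightarrow> (real ^ 'l \<Rightarrow> real ^ 'm \<Rightarrow> real) \<Rightarrow> real \<Rightarrow>
   (nat \<Rightarrow> real ^ 'l \<Rightarrow> real) \<Rightarrow> (nat \<Rightarrow> real ^ 'l \<Rightarrow> real ^ 'm) \<Rightarrow> bool"
where
  "boundary_condition U f r \<gamma> v \<pi> \<longleftrightarrow>
     (\<forall>i\<ge>1. admissible U f r \<gamma> (\<pi> (i - 1)) \<longrightarrow>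
        (\<forall>x. ((\<lambda>t. under_policy f (\<pi> (i - 1)) x (\<lambda>X a. \<gamma> powr t * v i (X t))) \<longlongrightarrow> 0) at_top))"


subsection \<open>The limit function and modes of convergence\<close>

text \<open>
  This is a supremum of reals, which is unspecified for unbounded sets. Whenever \<open>v i x\<close>
  converges as \<open>i\<close> tends to infinity, the values \<open>v i x\<close> are bounded and it is the true supremum.
\<close>

definition vhat :: "(nat \<Rightarrow> real ^ 'l \<Rightarrow> real) \<Rightarrow> real ^ 'l \<Rightarrow> real" where
  "vhat v x = (SUP i\<in>{1..}. v i x)"

definition lower_semicontinuous :: "('a::topological_space \<Rightarrow> real) \<Rightarrow> bool" where
  "lower_semicontinuous g \<longleftrightarrow> (\<forall>x c. c < g x \<longrightarrow> (\<forall>\<^sub>F y in nhds x. c < g y))"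

definition locally_uniform_limit ::
  "(nat \<Rightarrow> 'a::topological_space \<Rightarrow> 'b::metric_space) \<Rightarrow> ('a \<Rightarrow> 'b) \<Rightarrow> bool"
where
  "locally_uniform_limit g l \<longleftrightarrow>
     (\<forall>x. \<exists>N. open N \<and> x \<in> N \<and> uniform_limit N g l sequentially)"

end

theory Submission
  imports Defs
begin

text \<open>
  Let \<open>J(T)\<close> be the discounted reward collected up to time \<open>T\<close> along the trajectory \<open>X\<close> from \<open>x\<close>. The
  function \<open>J(T) + \<gamma>\<^sup>T w(X(T))\<close> of \<open>T\<close> has derivative \<open>\<gamma>\<^sup>T (h(X, \<pi>(X), \<nabla>w(X)) - \<alpha> w(X))\<close>. It is therefore
  constant in the evaluation step of DPI; in IPI it is constant along multiples of \<open>\<eta>\<close>, so the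
  boundary condition identifies \<open>v\<^sub>i\<close> with the value function of the previous policy and the function is
  constant after all. After improvement it is nondecreasing along the new policy, so \<open>v\<^sub>i(x)\<close> is a lower
  bound for the new value function, while the maximal reward gives an upper bound independent of \<open>i\<close>.
  By induction every policy is admissible and \<open>v\<^sub>i\<close> is a bounded nondecreasing sequence of continuous
  functions; the uniform statements follow from Dini's theorem.
\<close>

section \<open>Preliminaries from real analysis\<close>

text \<open>At interior points the filter \<open>at t within {0..}\<close> is the full filter
  \<open>at t\<close>, so the mean value theorem applies there; at the end points of the interval
  continuity suffices. This accommodates the one-sided derivative of a trajectory at time 0.\<close>

lemma nondecreasing_of_deriv_within:
  fixes F :: "real \<Rightarrow> real"
  assumes der: "\<And>t. 0 \<le> t \<Longrightarrow> (F has_real_derivative F' t) (at t within {0..})"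
    and nonneg: "\<And>t. 0 \<le> t \<Longrightarrow> 0 \<le> F' t"
    and "0 \<le> a" "a \<le> b"
  shows "F a \<le> F b"
proof (rule DERIV_nonneg_imp_increasing_open[OF \<open>a \<le> b\<close>])
  fix t assume "a < t" "t < b"
  then have "at t within {0..} = at t"
    using \<open>0 \<le> a\<close> by (intro at_within_open_subset[of _ "{0<..}"]) auto
  then have "(F has_real_derivative F' t) (at t)"
    using der[of t] \<open>a < t\<close> \<open>0 \<le> a\<close> by simp
  then show "\<exists>y. (F has_real_derivative y) (at t) \<and> 0 \<le> y"
    using nonneg[of t] \<open>a < t\<close> \<open>0 \<le> a\<close> by auto
next
  have "continuous_on {0..} F"
    using der DERIV_continuous_on[of "{0..}" F F'] by auto
  then show "continuous_on {a..b} F"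
    by (rule continuous_on_subset) (use \<open>0 \<le> a\<close> in auto)
qed

lemma integral_has_real_derivative_atLeast:
  fixes g :: "real \<Rightarrow> real"
  assumes "continuous_on {0..} g" "0 \<le> t"
  shows "((\<lambda>T. integral {0..T} g) has_real_derivative g t) (at t within {0..})"
proof -
  \<comment> \<open>Derivatives are local, so the half-line may be cut down to a compact interval,
    where the fundamental theorem of calculus applies.\<close>
  have "at t within {0..} = at t within {0..t + 1}"
    by (rule at_within_nhd[of t "{..<t + 1}"]) auto
  then show ?thesis
    using integral_has_real_derivative[of 0 "t + 1" g t] assms
    by (simp add: continuous_on_subset[OF assms(1)] subset_iff)
qed

lemma antimono_bounded_below_convergent_at_top:
  fixes K :: "real \<Rightarrow> real"
  assumes anti: "\<And>s t. 0 \<le> s \<Longrightarrow> s \<le> t \<Longrightarrow> K t \<le> K s"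
    and bdd: "\<And>t. 0 \<le> t \<Longrightarrow> b \<le> K t"
  shows "\<exists>L. (K \<longlongrightarrow> L) at_top"
proof -
  define L where "L = (INF t\<in>{0..}. K t)"
  have bb: "bdd_below (K ` {0..})"
    by (rule bdd_belowI2[of _ b]) (use bdd in auto)
  have "(K \<longlongrightarrow> L) at_top"
  proof (rule decreasing_tendsto)
    show "\<forall>\<^sub>F t in at_top. L \<le> K t"
      using eventually_ge_at_top[of 0]
      by eventually_elim (auto simp: L_def intro: cINF_lower[OF bb])
    fix y assume "L < y"
    then obtain s where "0 \<le> s" "K s < y"
      unfolding L_def using bb by (subst (asm) cINF_less_iff) auto
    then show "\<forall>\<^sub>F t in at_top. K t < y"
      by (intro eventually_mono[OF eventually_ge_at_top[of s]]) (use anti in force)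
  qed
  then show ?thesis by blast
qed

text \<open>Where the gap to the limit is at least \<open>e\<close>, one has nested compact sets
  \<open>S n\<close>. If none were empty, a common point would violate pointwise convergence; once
  one is empty, monotonicity keeps the gap below \<open>e\<close> from then on.\<close>

lemma Dini_uniform_limit:
  fixes w :: "nat \<Rightarrow> 'a::heine_borel \<Rightarrow> real"
  assumes "compact K"
    and w: "\<And>n. continuous_on K (w n)" and g: "continuous_on K g"
    and inc: "\<And>x. x \<in> K \<Longrightarrow> incseq (\<lambda>n. w n x)"
    and lim: "\<And>x. x \<in> K \<Longrightarrow> (\<lambda>n. w n x) \<longlonglongrightarrow> g x"
  shows "uniform_limit K w g sequentially"
proof (rule uniform_limitI)
  fix e :: real assume "0 < e"
  define S where "S n = {x \<in> K. w n x \<le> g x - e}" for n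
  have "\<exists>n. S n = {}"
  proof (rule ccontr)
    assume "\<nexists>n. S n = {}"
    moreover have "compact (S n)" for n
    proof -
      have "closed (S n)"
        unfolding S_def
        by (intro continuous_on_closed_Collect_le continuous_intros w g compact_imp_closed \<open>compact K\<close>)
      then show ?thesis
        using compact_Int_closed[OF \<open>compact K\<close>, of "S n"]
        by (simp add: S_def Collect_conj_eq inf.absorb2)
    qed
    moreover have "S n \<subseteq> S m" if "m \<le> n" for m n
      using inc that by (force simp: S_def incseq_def)
    ultimately have "\<Inter> (range S) \<noteq> {}"
      by (intro compact_nest) auto
    then obtain x where x: "\<And>n. x \<in> S n" by auto
    then have "x \<in> K" by (auto simp: S_def)
    have "g x \<le> g x - e"
      by (rule LIMSEQ_le_const2[OF lim[OF \<open>x \<in> K\<close>]]) (use x in \<open>auto simp: S_def\<close>)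
    then show False using \<open>0 < e\<close> by simp
  qed
  then obtain N where N: "S N = {}" by blast
  have "dist (w n x) (g x) < e" if "N \<le> n" "x \<in> K" for n x
  proof -
    have "w N x \<le> w n x" using inc that by (auto simp: incseq_def)
    moreover have "w n x \<le> g x" using incseq_le[OF inc lim] that by auto
    moreover have "g x - e < w N x" using N that by (force simp: S_def)
    ultimately show ?thesis by (simp add: dist_real_def)
  qed
  then show "\<forall>\<^sub>F n in sequentially. \<forall>x\<in>K. dist (w n x) (g x) < e"
    by (auto simp: eventually_sequentially)
qed

text \<open>The witness is the Riesz vector of the derivative. Uniqueness matters too, because
  \<open>grad\<close> is a definite description.\<close>

lemma GDERIV_grad:
  fixes v :: "real ^ 'l \<Rightarrow> real"
  assumes "v differentiable (at x)"
  shows "GDERIV v x :> grad v x"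
proof -
  obtain D where D: "(v has_derivative D) (at x)"
    using assms by (auto simp: differentiable_def)
  define p where "p = (\<Sum>b\<in>Basis. D b *\<^sub>R b)"
  have "D h = h \<bullet> p" for h
  proof -
    have "linear D" using D by (simp add: has_derivative_linear)
    then have "D h = (\<Sum>b\<in>Basis. (h \<bullet> b) * D b)"
      by (subst euclidean_representation[of h, symmetric]) (simp add: linear_sum linear_scale)
    then show ?thesis by (simp add: p_def inner_sum_right mult.commute)
  qed
  then have "D = (\<lambda>h. h \<bullet> p)" by auto
  then have p: "GDERIV v x :> p" using D by (simp add: gderiv_def)
  show ?thesis
    unfolding grad_def
  proof (rule theI[where P = "\<lambda>p. GDERIV v x :> p", OF p])
    fix q assume "GDERIV v x :> q"
    then have "(\<lambda>h. h \<bullet> q) = (\<lambda>h. h \<bullet> p)"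
      using p by (auto simp: gderiv_def intro: has_derivative_unique)
    \<comment> \<open>Two representing vectors are compared by evaluating both functionals at their
      difference.\<close>
    then have "(q - p) \<bullet> q = (q - p) \<bullet> p" by (rule fun_cong)
    then have "(q - p) \<bullet> (q - p) = 0" by (simp only: inner_diff_right)
    then show "q = p" by simp
  qed
qed

lemma C1_continuous_on: "C1 v \<Longrightarrow> continuous_on S v"
  by (meson C1_def continuous_at_imp_continuous_on differentiable_imp_continuous_within)

lemma policy_iteration_C1:
  assumes "DPI U f r \<gamma> v \<pi> \<or> IPI U f r \<gamma> \<eta> f\<^sub>d f\<^sub>c v \<pi>" "1 \<le> i"
  shows "C1 (v i)"
  using assms unfolding DPI_def IPI_def by blast

section \<open>Notation, reward bound and discounting\<close>

context rl_problem
begin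

definition flow :: "(real ^ 'l \<Rightarrow> real ^ 'm) \<Rightarrow> real ^ 'l \<Rightarrow> real \<Rightarrow> real ^ 'l" where
  "flow \<pi> x = (THE X. policy_trajectory f \<pi> x X)"

definition payoff :: "(real ^ 'l \<Rightarrow> real ^ 'm) \<Rightarrow> real ^ 'l \<Rightarrow> real \<Rightarrow> real" where
  "payoff \<pi> x T = discounted_reward r \<gamma> T (flow \<pi> x) (\<lambda>t. \<pi> (flow \<pi> x t))"

definition reward_bound :: real where
  "reward_bound = (SOME M. (\<forall>x. \<forall>u\<in>U. r x u \<le> M) \<and> (\<gamma> = 1 \<longrightarrow> M = 0))"

text \<open>For \<open>\<gamma> = 1\<close> this is a division by zero, whose value 0 is the right bound.\<close>

definition value_bound :: real where
  "value_bound = reward_bound / (- ln \<gamma>)"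

lemma under_policy_eq: "under_policy f \<pi> x Y = Y (flow \<pi> x) (\<lambda>t. \<pi> (flow \<pi> x t))"
  by (simp add: under_policy_def flow_def Let_def)

lemma reward_bound: "u \<in> U \<Longrightarrow> r x u \<le> reward_bound" "\<gamma> = 1 \<Longrightarrow> reward_bound = 0"
proof -
  have "(\<forall>x. \<forall>u\<in>U. r x u \<le> reward_bound) \<and> (\<gamma> = 1 \<longrightarrow> reward_bound = 0)"
    unfolding reward_bound_def by (rule someI_ex) (use reward_max in blast)
  then show "u \<in> U \<Longrightarrow> r x u \<le> reward_bound" "\<gamma> = 1 \<Longrightarrow> reward_bound = 0" by auto
qed

text \<open>The constant \<open>value_bound\<close> is the total discounted value of the constant
  reward \<open>reward_bound\<close>. Multiplied out, the relation also covers \<gamma> = 1, where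
  both sides vanish.\<close>

lemma value_bound_rate: "(- ln \<gamma>) * value_bound = reward_bound"
  using reward_bound(2) discount by (cases "\<gamma> = 1") (auto simp: value_bound_def)

lemma discount_deriv:
  "((\<lambda>t. \<gamma> powr t) has_real_derivative ln \<gamma> * \<gamma> powr t) (at t within S)"
proof -
  have "((\<lambda>t. exp (t * ln \<gamma>)) has_real_derivative ln \<gamma> * exp (t * ln \<gamma>)) (at t within S)"
    by (auto intro!: derivative_eq_intros)
  then show ?thesis using discount by (simp add: powr_def)
qed

text \<open>For \<gamma> < 1 the discount factor decays; for \<gamma> = 1 it does not, but then the
  constant itself is 0.\<close>

lemma discounted_bound_tendsto: "((\<lambda>t. \<gamma> powr t * value_bound) \<longlongrightarrow> 0) at_top"
proof (cases "\<gamma> = 1")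
  case True
  then have "value_bound = 0" unfolding value_bound_def by simp
  then show ?thesis by simp
next
  case False
  then have "ln \<gamma> < 0" using discount by simp
  then have "filterlim (\<lambda>t. t * - ln \<gamma>) at_top at_top"
    by (intro filterlim_at_top_mult_tendsto_pos[OF tendsto_const] filterlim_ident) simp
  then have "filterlim (\<lambda>t. t * ln \<gamma>) at_bot at_top"
    unfolding filterlim_uminus_at_bot by simp
  from filterlim_compose[OF exp_at_bot this]
  have "((\<lambda>t. \<gamma> powr t) \<longlongrightarrow> 0) at_top"
    using discount by (simp add: powr_def)
  then show ?thesis by (rule tendsto_mult_left_zero)
qed

section \<open>Flow and payoff of a fixed policy\<close>

context
  fixes \<pi> :: "real ^ 'l \<Rightarrow> real ^ 'm"
  assumes policy: "policy U \<pi>"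
begin

lemma policy_in: "\<pi> x \<in> U"
  using policy by (auto simp: policy_def)

lemma flow_trajectory: "policy_trajectory f \<pi> x (flow \<pi> x)"
  unfolding flow_def by (rule theI'[OF policy_trajectory_unique[OF policy]])

lemma flow_0: "flow \<pi> x 0 = x"
  using flow_trajectory[of x] by (simp add: policy_trajectory_def trajectory_def)

lemma flow_deriv:
  "0 \<le> t \<Longrightarrow> (flow \<pi> x has_vector_derivative f (flow \<pi> x t) (\<pi> (flow \<pi> x t))) (at t within {0..})"
  using flow_trajectory[of x] by (simp add: policy_trajectory_def trajectory_def)

lemma flow_continuous: "continuous_on {0..} (flow \<pi> x)"
  unfolding continuous_on_eq_continuous_within
  using has_vector_derivative_continuous[OF flow_deriv] by simp

text \<open>Under a policy the equation is autonomous, so a time-shifted trajectory solves it again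
  from the state reached, and uniqueness identifies the two.\<close>

lemma flow_add:
  assumes "0 \<le> s" "0 \<le> t"
  shows "flow \<pi> x (s + t) = flow \<pi> (flow \<pi> x s) t"
proof -
  \<comment> \<open>The restriction makes the shifted trajectory extensional, as
    \<open>trajectory\<close> demands.\<close>
  define Y where "Y = restrict (\<lambda>t. flow \<pi> x (s + t)) {0..}"
  have "policy_trajectory f \<pi> (flow \<pi> x s) Y"
    unfolding policy_trajectory_def trajectory_def
  proof (intro conjI allI impI)
    show "Y \<in> extensional {0..}" "Y 0 = flow \<pi> x s" by (simp_all add: Y_def)
    fix t :: real assume t: "0 \<le> t"
    have "((flow \<pi> x \<circ> (\<lambda>t. s + t)) has_vector_derivative
        1 *\<^sub>R f (flow \<pi> x (s + t)) (\<pi> (flow \<pi> x (s + t)))) (at t within {0..})"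
    proof (rule vector_diff_chain_within)
      show "((\<lambda>t. s + t) has_vector_derivative 1) (at t within {0..})"
        by (auto intro!: derivative_eq_intros)
      show "(flow \<pi> x has_vector_derivative f (flow \<pi> x (s + t)) (\<pi> (flow \<pi> x (s + t))))
          (at (s + t) within (\<lambda>t. s + t) ` {0..})"
        by (rule has_vector_derivative_within_subset[OF flow_deriv]) (use assms t in auto)
    qed
    then show "(Y has_vector_derivative f (Y t) (\<pi> (Y t))) (at t within {0..})"
      using t by (auto simp: Y_def o_def intro: has_vector_derivative_transform[rotated 2])
  qed
  then have "Y = flow \<pi> (flow \<pi> x s)"
    using policy_trajectory_unique[OF policy] flow_trajectory by blast
  then show ?thesis using assms by (metis Y_def atLeast_iff restrict_apply)
qed

lemma reward_along_continuous:
  "continuous_on {0..} (\<lambda>t. \<gamma> powr t * r (flow \<pi> x t) (\<pi> (flow \<pi> x t)))"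
proof -
  have "continuous_on {0..} (\<lambda>t. \<pi> (flow \<pi> x t))"
    using policy by (auto simp: policy_def intro: continuous_on_compose2[OF _ flow_continuous])
  then have "continuous_on {0..} (\<lambda>t. (flow \<pi> x t, \<pi> (flow \<pi> x t)))"
    by (intro continuous_intros flow_continuous)
  then have "continuous_on {0..} (\<lambda>t. (\<lambda>(x, u). r x u) (flow \<pi> x t, \<pi> (flow \<pi> x t)))"
    by (rule continuous_on_compose2[OF reward_continuous]) (auto simp: policy_in)
  then show ?thesis
    using discount by (auto intro!: continuous_intros)
qed

lemma payoff_0: "payoff \<pi> x 0 = 0"
  by (simp add: payoff_def discounted_reward_def)

lemma payoff_deriv:
  "0 \<le> t \<Longrightarrow> (payoff \<pi> x has_real_derivative \<gamma> powr t * r (flow \<pi> x t) (\<pi> (flow \<pi> x t)))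
     (at t within {0..})"
  unfolding payoff_def[abs_def] discounted_reward_def
  by (rule integral_has_real_derivative_atLeast[OF reward_along_continuous])

text \<open>The integral is split at \<open>s\<close> and its second piece shifted to start at 0;
  the flow property rewrites the reward and the discount contributes the factor
  \<open>\<gamma> powr s\<close>.\<close>

lemma payoff_add:
  assumes "0 \<le> s" "0 \<le> t"
  shows "payoff \<pi> x (s + t) = payoff \<pi> x s + \<gamma> powr s * payoff \<pi> (flow \<pi> x s) t"
proof -
  define g where "g t = \<gamma> powr t * r (flow \<pi> x t) (\<pi> (flow \<pi> x t))" for t
  have cont: "continuous_on {0..} g"
    using reward_along_continuous by (simp add: g_def[abs_def])
  have "\<gamma> powr s * payoff \<pi> (flow \<pi> x s) t = integral {0..t} (g \<circ> (+) s)"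
    unfolding payoff_def discounted_reward_def integral_mult_right[symmetric]
    using assms by (intro integral_cong) (auto simp: g_def flow_add powr_add)
  also have "\<dots> = integral {s..s + t} g"
    by (simp add: integral_shift_Icc_real add.commute)
  finally show ?thesis
    using Henstock_Kurzweil_Integration.integral_combine[of 0 s "s + t" g] assms
    by (simp add: payoff_def discounted_reward_def g_def[abs_def, symmetric]
        integrable_continuous_real continuous_on_subset[OF cont] subset_iff)
qed

section \<open>Convergence of the payoff\<close>

text \<open>
  Adding \<open>\<gamma> powr t * value_bound\<close> amounts to replacing the reward \<open>r\<close> by \<open>r - reward_bound \<le> 0\<close>, up to
  a constant. This settles the existence of the improper integral for all \<open>\<gamma> \<le> 1\<close> at once.
\<close>

lemma compensated_antimono:
  assumes "0 \<le> s" "s \<le> t"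
  shows "payoff \<pi> x t + \<gamma> powr t * value_bound \<le> payoff \<pi> x s + \<gamma> powr s * value_bound"
proof -
  have "- (payoff \<pi> x s + \<gamma> powr s * value_bound) \<le> - (payoff \<pi> x t + \<gamma> powr t * value_bound)"
  proof (rule nondecreasing_of_deriv_within[OF _ _ assms])
    fix t :: real assume t: "0 \<le> t"
    show "((\<lambda>t. - (payoff \<pi> x t + \<gamma> powr t * value_bound)) has_real_derivative
        \<gamma> powr t * (reward_bound - r (flow \<pi> x t) (\<pi> (flow \<pi> x t)))) (at t within {0..})"
      using discount
      by (auto intro!: derivative_eq_intros discount_deriv payoff_deriv t
          simp: value_bound_rate[symmetric] algebra_simps)
    show "0 \<le> \<gamma> powr t * (reward_bound - r (flow \<pi> x t) (\<pi> (flow \<pi> x t)))"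
      using reward_bound(1)[OF policy_in] by simp
  qed
  then show ?thesis by simp
qed

lemma payoff_le: "0 \<le> t \<Longrightarrow> payoff \<pi> x t + \<gamma> powr t * value_bound \<le> value_bound"
  using compensated_antimono[of 0 t x] discount by (simp add: payoff_0)

text \<open>The compensated payoff is antitone, so a lower bound forces a finite limit; the
  compensation vanishes at infinity, so the payoff has the same limit.\<close>

lemma payoff_convergent:
  assumes "\<And>t. 0 \<le> t \<Longrightarrow> b \<le> payoff \<pi> x t + \<gamma> powr t * value_bound"
  obtains L where "(payoff \<pi> x \<longlongrightarrow> L) at_top" "b \<le> L" "L \<le> value_bound"
proof -
  obtain L where L: "((\<lambda>t. payoff \<pi> x t + \<gamma> powr t * value_bound) \<longlongrightarrow> L) at_top"
    using antimono_bounded_below_convergent_at_top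
      [where K = "\<lambda>t. payoff \<pi> x t + \<gamma> powr t * value_bound" and b = b,
        OF compensated_antimono assms]
    by blast
  show thesis
  proof
    show "(payoff \<pi> x \<longlongrightarrow> L) at_top"
      using tendsto_diff[OF L discounted_bound_tendsto] by simp
    show "b \<le> L"
      by (rule tendsto_lowerbound[OF L])
         (auto intro: eventually_mono[OF eventually_ge_at_top[of 0]] assms)
    show "L \<le> value_bound"
      by (rule tendsto_upperbound[OF L])
         (auto intro: eventually_mono[OF eventually_ge_at_top[of 0]] payoff_le)
  qed
qed

lemma VF_eqI:
  assumes "(payoff \<pi> x \<longlongrightarrow> L) at_top"
  shows "VF f r \<gamma> \<pi> x = ereal L"
proof -
  have "VF f r \<gamma> \<pi> x = Lim at_top (\<lambda>T. ereal (payoff \<pi> x T))"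
    by (simp only: VF_def under_policy_eq payoff_def)
  also have "\<dots> = ereal L"
    by (intro tendsto_Lim tendsto_ereal assms) simp
  finally show ?thesis .
qed

section \<open>Bellman identities along trajectories\<close>

text \<open>The reward in the Hamiltonian comes from the payoff, its gradient term from the chain
  rule along the flow, and \<open>ln \<gamma> * v\<close> from differentiating the discount.\<close>

lemma total_deriv:
  assumes "C1 v" "0 \<le> t"
  shows "((\<lambda>t. payoff \<pi> x t + \<gamma> powr t * v (flow \<pi> x t)) has_real_derivative
    \<gamma> powr t * (ln \<gamma> * v (flow \<pi> x t)
      + hamiltonian f r (flow \<pi> x t) (\<pi> (flow \<pi> x t)) (grad v (flow \<pi> x t)))) (at t within {0..})"
proof -
  let ?X = "flow \<pi> x"
  have "(v has_derivative (\<lambda>h. h \<bullet> grad v (?X t))) (at (?X t) within ?X ` {0..})"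
    using GDERIV_grad[of v "?X t"] assms(1)
    by (auto simp: C1_def gderiv_def intro: has_derivative_at_withinI)
  then have "((v \<circ> ?X) has_vector_derivative f (?X t) (\<pi> (?X t)) \<bullet> grad v (?X t)) (at t within {0..})"
    by (rule vector_derivative_diff_chain_within[OF flow_deriv[OF assms(2)]])
  then have *: "((\<lambda>t. v (?X t)) has_real_derivative f (?X t) (\<pi> (?X t)) \<bullet> grad v (?X t)) (at t within {0..})"
    by (simp add: has_real_derivative_iff_has_vector_derivative o_def)
  show ?thesis
    using discount
    by (auto intro!: derivative_eq_intros discount_deriv payoff_deriv * assms(2)
        simp: hamiltonian_def inner_commute algebra_simps)
qed

lemma bellman_le:
  assumes "C1 v" "\<And>y. 0 \<le> ln \<gamma> * v y + hamiltonian f r y (\<pi> y) (grad v y)" "0 \<le> T"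
  shows "v x \<le> payoff \<pi> x T + \<gamma> powr T * v (flow \<pi> x T)"
proof -
  have "payoff \<pi> x 0 + \<gamma> powr 0 * v (flow \<pi> x 0) \<le> payoff \<pi> x T + \<gamma> powr T * v (flow \<pi> x T)"
    by (rule nondecreasing_of_deriv_within
          [where F = "\<lambda>t. payoff \<pi> x t + \<gamma> powr t * v (flow \<pi> x t)", OF total_deriv[OF assms(1)]])
       (use assms(2,3) in auto)
  then show ?thesis using discount by (simp add: payoff_0 flow_0)
qed

lemma bellman_eq:
  assumes "C1 v" "\<And>y. ln \<gamma> * v y + hamiltonian f r y (\<pi> y) (grad v y) = 0" "0 \<le> T"
  shows "v x = payoff \<pi> x T + \<gamma> powr T * v (flow \<pi> x T)"
proof -
  have "\<exists>c. \<forall>t\<in>{0..}. payoff \<pi> x t + \<gamma> powr t * v (flow \<pi> x t) = c"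
    by (rule has_field_derivative_zero_constant)
       (use total_deriv[OF assms(1)] assms(2) in auto)
  then have "payoff \<pi> x 0 + \<gamma> powr 0 * v (flow \<pi> x 0) = payoff \<pi> x T + \<gamma> powr T * v (flow \<pi> x T)"
    using \<open>0 \<le> T\<close> by (metis atLeast_iff order_refl)
  then show ?thesis using discount by (simp add: payoff_0 flow_0)
qed

text \<open>The Bellman identity makes the total constant in time, and its one-sided derivative at
  time 0 is the Hamiltonian residual at \<open>x\<close>. One-sided derivatives are unique because 0
  is a limit point of the half-line.\<close>

lemma bellman_imp_hamiltonian:
  assumes "C1 v" and eq: "\<And>T. 0 \<le> T \<Longrightarrow> v x = payoff \<pi> x T + \<gamma> powr T * v (flow \<pi> x T)"
  shows "ln \<gamma> * v x + hamiltonian f r x (\<pi> x) (grad v x) = 0"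
proof -
  let ?D = "ln \<gamma> * v x + hamiltonian f r x (\<pi> x) (grad v x)"
  have "((\<lambda>t. payoff \<pi> x t + \<gamma> powr t * v (flow \<pi> x t)) has_real_derivative ?D) (at 0 within {0..})"
    using total_deriv[OF assms(1), of 0 x] discount by (simp add: flow_0)
  then have "((\<lambda>t. v x) has_real_derivative ?D) (at 0 within {0..})"
    by (rule has_field_derivative_transform_within[where d = 1]) (auto simp flip: eq)
  moreover have "((\<lambda>t. v x) has_real_derivative 0) (at 0 within {0..})" by simp
  moreover have "at (0::real) within {0..} \<noteq> bot"
    by (simp add: at_within_Ici_at_right)
  ultimately show ?thesis
    by (metis has_field_derivative_unique)
qed

lemma integral_bellman_iterate:
  assumes "0 < \<eta>" and eq: "\<And>y. v y = payoff \<pi> y \<eta> + \<gamma> powr \<eta> * v (flow \<pi> y \<eta>)"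
  shows "v x = payoff \<pi> x (real n * \<eta>) + \<gamma> powr (real n * \<eta>) * v (flow \<pi> x (real n * \<eta>))"
proof (induction n)
  case 0
  then show ?case using discount by (simp add: payoff_0 flow_0)
next
  case (Suc n)
  have nonneg: "0 \<le> real n * \<eta>" "0 \<le> \<eta>" using \<open>0 < \<eta>\<close> by auto
  have Suc_mult: "real (Suc n) * \<eta> = real n * \<eta> + \<eta>" by (simp add: algebra_simps)
  show ?case
    unfolding Suc_mult payoff_add[OF nonneg] flow_add[OF nonneg] powr_add
    using Suc eq[of "flow \<pi> x (real n * \<eta>)"] by (simp add: algebra_simps)
qed

text \<open>Iteration gives the limit only along multiples of \<eta>. The antitone compensated
  payoff stays above this limit at all times, hence converges, and the subsequence identifies its
  limit.\<close>

lemma integral_bellman_payoff_tendsto: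
  assumes "0 < \<eta>" and eq: "\<And>y. v y = payoff \<pi> y \<eta> + \<gamma> powr \<eta> * v (flow \<pi> y \<eta>)"
    and lim: "((\<lambda>t. \<gamma> powr t * v (flow \<pi> x t)) \<longlongrightarrow> 0) at_top"
  shows "(payoff \<pi> x \<longlongrightarrow> v x) at_top"
proof -
  let ?K = "\<lambda>t. payoff \<pi> x t + \<gamma> powr t * value_bound"
  have n: "filterlim (\<lambda>n. real n * \<eta>) at_top sequentially"
    by (intro filterlim_at_top_mult_tendsto_pos[OF tendsto_const \<open>0 < \<eta>\<close>] filterlim_real_sequentially)
  have "(\<lambda>n. v x - \<gamma> powr (real n * \<eta>) * v (flow \<pi> x (real n * \<eta>))) \<longlonglongrightarrow> v x"
    by (subst (2) diff_0_right[symmetric], intro tendsto_diff tendsto_const filterlim_compose[OF lim n])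
  then have sub: "(\<lambda>n. payoff \<pi> x (real n * \<eta>)) \<longlonglongrightarrow> v x"
    by (rule Lim_transform_eventually) (use integral_bellman_iterate[OF assms(1,2), of x] in \<open>auto simp: algebra_simps\<close>)
  then have K: "(\<lambda>n. ?K (real n * \<eta>)) \<longlonglongrightarrow> v x"
    using tendsto_add[OF sub filterlim_compose[OF discounted_bound_tendsto n]] by simp
  have "v x \<le> ?K t" if "0 \<le> t" for t
  proof (rule tendsto_upperbound[OF K])
    show "\<forall>\<^sub>F n in sequentially. ?K (real n * \<eta>) \<le> ?K t"
      using filterlim_at_top[THEN iffD1, OF n, rule_format, of t]
      by eventually_elim (use compensated_antimono that in blast)
  qed simp
  then obtain L where L: "(payoff \<pi> x \<longlongrightarrow> L) at_top"
    using payoff_convergent by blast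
  then have "L = v x"
    using LIMSEQ_unique[OF sub filterlim_compose[OF L n]] by simp
  then show ?thesis using L by simp
qed

text \<open>The payoff up to time \<open>T + t\<close> is passed to the limit in two ways: directly,
  and after splitting at \<open>T\<close> and using the limit from the state reached there.\<close>

lemma integral_bellman_imp_bellman:
  assumes "0 < \<eta>" and eq: "\<And>y. v y = payoff \<pi> y \<eta> + \<gamma> powr \<eta> * v (flow \<pi> y \<eta>)"
    and lim: "\<And>y. ((\<lambda>t. \<gamma> powr t * v (flow \<pi> y t)) \<longlongrightarrow> 0) at_top"
    and "0 \<le> T"
  shows "v x = payoff \<pi> x T + \<gamma> powr T * v (flow \<pi> x T)"
proof -
  note payoff_lim = integral_bellman_payoff_tendsto[OF assms(1) eq lim]
  have "filterlim (\<lambda>t. T + t) at_top at_top"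
    by (rule filterlim_tendsto_add_at_top[OF tendsto_const filterlim_ident])
  from filterlim_compose[OF payoff_lim this]
  have "((\<lambda>t. payoff \<pi> x (T + t)) \<longlongrightarrow> v x) at_top" .
  moreover have "((\<lambda>t. payoff \<pi> x (T + t)) \<longlongrightarrow> payoff \<pi> x T + \<gamma> powr T * v (flow \<pi> x T)) at_top"
  proof (rule Lim_transform_eventually)
    show "((\<lambda>t. payoff \<pi> x T + \<gamma> powr T * payoff \<pi> (flow \<pi> x T) t) \<longlongrightarrow>
        payoff \<pi> x T + \<gamma> powr T * v (flow \<pi> x T)) at_top"
      by (intro tendsto_intros payoff_lim)
    show "\<forall>\<^sub>F t in at_top. payoff \<pi> x T + \<gamma> powr T * payoff \<pi> (flow \<pi> x T) t = payoff \<pi> x (T + t)"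
      using eventually_ge_at_top[of 0] by eventually_elim (simp add: payoff_add \<open>0 \<le> T\<close>)
  qed
  ultimately show ?thesis by (rule tendsto_unique[rotated]) simp
qed

lemma bellman_payoff_tendsto:
  assumes "\<And>T. 0 \<le> T \<Longrightarrow> v x = payoff \<pi> x T + \<gamma> powr T * v (flow \<pi> x T)"
    and "((\<lambda>t. \<gamma> powr t * v (flow \<pi> x t)) \<longlongrightarrow> 0) at_top"
  shows "(payoff \<pi> x \<longlongrightarrow> v x) at_top"
proof (rule Lim_transform_eventually)
  show "((\<lambda>t. v x - \<gamma> powr t * v (flow \<pi> x t)) \<longlongrightarrow> v x) at_top"
    using tendsto_diff[OF tendsto_const assms(2)] by simp
  show "\<forall>\<^sub>F t in at_top. v x - \<gamma> powr t * v (flow \<pi> x t) = payoff \<pi> x t"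
    using eventually_ge_at_top[of 0] by eventually_elim (use assms(1) in fastforce)
qed

lemma payoff_limit_le_value_bound:
  assumes "(payoff \<pi> x \<longlongrightarrow> L) at_top"
  shows "L \<le> value_bound"
proof (rule tendsto_upperbound)
  show "((\<lambda>t. payoff \<pi> x t + \<gamma> powr t * value_bound) \<longlongrightarrow> L) at_top"
    using tendsto_add[OF assms discounted_bound_tendsto] by simp
  show "\<forall>\<^sub>F t in at_top. payoff \<pi> x t + \<gamma> powr t * value_bound \<le> value_bound"
    using eventually_ge_at_top[of 0] by eventually_elim (rule payoff_le)
qed simp

text \<open>Along the improved policy, \<open>v \<le> value_bound\<close> turns the remainder in
  \<open>bellman_le\<close> into the compensation term. So \<open>v x\<close> bounds the compensated
  payoff from below, which is what \<open>payoff_convergent\<close> requires.\<close>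

lemma policy_improvement:
  assumes "C1 v" "\<And>y. 0 \<le> ln \<gamma> * v y + hamiltonian f r y (\<pi> y) (grad v y)"
    and "\<And>y. v y \<le> value_bound"
  obtains L where "(payoff \<pi> x \<longlongrightarrow> L) at_top" "v x \<le> L"
proof -
  have "v x \<le> payoff \<pi> x t + \<gamma> powr t * value_bound" if "0 \<le> t" for t
    using bellman_le[OF assms(1,2) that, of x] assms(3)[of "flow \<pi> x t"]
    by (smt (verit) mult_left_mono powr_ge_zero)
  then show thesis using payoff_convergent that by blast
qed

end

section \<open>One round of policy iteration and the induction\<close>

text \<open>DPI and IPI share this step, since both evaluations yield the Bellman identity for all
  times. Differentiating it makes the residual zero under \<open>\<pi>\<close>, hence nonnegative
  under \<open>\<pi>'\<close>.\<close>

lemma policy_iteration_step: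
  assumes \<pi>: "admissible U f r \<gamma> \<pi>" and \<pi>': "policy U \<pi>'"
    and "C1 v"
    and bellman: "\<And>x T. 0 \<le> T \<Longrightarrow> v x = payoff \<pi> x T + \<gamma> powr T * v (flow \<pi> x T)"
    and boundary: "\<And>x. ((\<lambda>t. \<gamma> powr t * v (flow \<pi> x t)) \<longlongrightarrow> 0) at_top"
    and improved: "\<And>x. hamiltonian f r x (\<pi> x) (grad v x) \<le> hamiltonian f r x (\<pi>' x) (grad v x)"
  shows "admissible U f r \<gamma> \<pi>'"
    and "ereal (v x) = VF f r \<gamma> \<pi> x"
    and "ereal (v x) \<le> VF f r \<gamma> \<pi>' x"
    and "v x \<le> value_bound"
proof -
  have pol: "policy U \<pi>" using \<pi> by (simp add: admissible_def)
  note lim = bellman_payoff_tendsto[OF pol bellman boundary]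
  show "ereal (v x) = VF f r \<gamma> \<pi> x" using VF_eqI[OF pol lim] by simp
  have bound: "v y \<le> value_bound" for y by (rule payoff_limit_le_value_bound[OF pol lim])
  then show "v x \<le> value_bound" .
  have "0 \<le> ln \<gamma> * v y + hamiltonian f r y (\<pi>' y) (grad v y)" for y
    using bellman_imp_hamiltonian[OF pol \<open>C1 v\<close> bellman, of y] improved[of y] by simp
  then have "\<exists>L. (payoff \<pi>' y \<longlongrightarrow> L) at_top \<and> v y \<le> L" for y
    using policy_improvement[OF \<pi>' \<open>C1 v\<close> _ bound] by metis
  then have *: "\<exists>L. VF f r \<gamma> \<pi>' y = ereal L \<and> v y \<le> L" for y
    using VF_eqI[OF \<pi>'] by metis
  show "admissible U f r \<gamma> \<pi>'"
    unfolding admissible_def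
  proof (intro conjI allI \<pi>')
    show "\<bar>VF f r \<gamma> \<pi>' y\<bar> \<noteq> \<infinity>" for y using *[of y] by auto
  qed
  show "ereal (v x) \<le> VF f r \<gamma> \<pi>' x" using *[of x] by auto
qed

text \<open>Each \<open>v i\<close> is at most the value function of \<open>\<pi> i\<close>, which
  the next evaluation identifies with \<open>v (Suc i)\<close>.\<close>

lemma policy_iteration_monotone_bounded:
  assumes alg: "DPI U f r \<gamma> v \<pi> \<or> IPI U f r \<gamma> \<eta> f\<^sub>d f\<^sub>c v \<pi>"
    and bc: "boundary_condition U f r \<gamma> v \<pi>"
    and "1 \<le> i"
  shows "v i x \<le> v (Suc i) x" "v i x \<le> value_bound"
proof -
  have adm0: "admissible U f r \<gamma> (\<pi> 0)"
    using alg unfolding DPI_def IPI_def by blast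
  have "policy U (\<pi> i)" if "1 \<le> i" for i
    using alg that unfolding DPI_def IPI_def by blast
  \<comment> \<open>From here on facts are indexed by \<open>Suc i\<close>, which turns
    \<open>\<pi> (i - 1)\<close> and \<open>v i\<close> into \<open>\<pi> i\<close> and
    \<open>v (Suc i)\<close>.\<close>
  then have pol: "policy U (\<pi> (Suc i))" for i by simp
  have C1: "C1 (v (Suc i))" for i
    using policy_iteration_C1[OF alg, of "Suc i"] by simp
  have boundary: "((\<lambda>t. \<gamma> powr t * v (Suc i) (flow (\<pi> i) x t)) \<longlongrightarrow> 0) at_top"
    if "admissible U f r \<gamma> (\<pi> i)" for i x
    using bc[unfolded boundary_condition_def, rule_format, of "Suc i"] that
    by (simp add: under_policy_eq)
  have bellman: "v (Suc i) x = payoff (\<pi> i) x T + \<gamma> powr T * v (Suc i) (flow (\<pi> i) x T)"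
    if "0 \<le> T" "admissible U f r \<gamma> (\<pi> i)" for i x T
  proof -
    have p: "policy U (\<pi> i)" using that by (simp add: admissible_def)
    from alg show ?thesis
    proof
      assume "DPI U f r \<gamma> v \<pi>"
      then have "(- ln \<gamma>) * v j y = hamiltonian f r y (\<pi> (j - 1) y) (grad (v j) y)" if "1 \<le> j" for j y
        using that unfolding DPI_def by blast
      from this[of "Suc i"]
      have hjb: "hamiltonian f r y (\<pi> i y) (grad (v (Suc i)) y) = (- ln \<gamma>) * v (Suc i) y" for y
        by simp
      show ?thesis
        by (rule bellman_eq[OF p C1 _ that(1)]) (simp add: hjb)
    next
      assume ipi: "IPI U f r \<gamma> \<eta> f\<^sub>d f\<^sub>c v \<pi>"
      then have "0 < \<eta>" unfolding IPI_def by blast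
      have evaluation: "v j y = under_policy f (\<pi> (j - 1)) y
          (\<lambda>X a. discounted_reward r \<gamma> \<eta> X a + \<gamma> powr \<eta> * v j (X \<eta>))" if "1 \<le> j" for j y
        using ipi that unfolding IPI_def by blast
      have "v (Suc i) y = payoff (\<pi> i) y \<eta> + \<gamma> powr \<eta> * v (Suc i) (flow (\<pi> i) y \<eta>)" for y
        using evaluation[of "Suc i" y] unfolding under_policy_eq payoff_def diff_Suc_1 by linarith
      then show ?thesis
        by (rule integral_bellman_imp_bellman[OF p \<open>0 < \<eta>\<close> _ boundary[OF that(2)] that(1)])
    qed
  qed
  have improved: "hamiltonian f r x u (grad (v (Suc i)) x)
      \<le> hamiltonian f r x (\<pi> (Suc i) x) (grad (v (Suc i)) x)" if "u \<in> U" for i x u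
  proof -
    have "1 \<le> Suc i" by simp
    from alg show ?thesis
    proof
      assume "DPI U f r \<gamma> v \<pi>"
      then have "is_arg_max (\<lambda>u. hamiltonian f r x u (grad (v (Suc i)) x)) (\<lambda>u. u \<in> U) (\<pi> (Suc i) x)"
        using \<open>1 \<le> Suc i\<close> unfolding DPI_def by blast
      then show ?thesis using that by (auto simp: is_arg_max_def not_less)
    next
      assume ipi: "IPI U f r \<gamma> \<eta> f\<^sub>d f\<^sub>c v \<pi>"
      then have "is_arg_max (\<lambda>u. r x u + grad (v (Suc i)) x \<bullet> f\<^sub>c x u) (\<lambda>u. u \<in> U) (\<pi> (Suc i) x)"
        using \<open>1 \<le> Suc i\<close> unfolding IPI_def by blast
      \<comment> \<open>The IPI objective differs from the Hamiltonian by
        \<open>grad (v (Suc i)) x \<bullet> f\<^sub>d x\<close>, which does not depend on the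
        action.\<close>
      moreover have "f x u = f\<^sub>d x + f\<^sub>c x u" if "u \<in> U" for u
        using ipi that unfolding IPI_def by blast
      ultimately show ?thesis
        using that by (auto simp: is_arg_max_def not_less hamiltonian_def inner_add_right)
    qed
  qed
  have step: "admissible U f r \<gamma> (\<pi> (Suc i)) \<and> ereal (v (Suc i) x) = VF f r \<gamma> (\<pi> i) x \<and>
      ereal (v (Suc i) x) \<le> VF f r \<gamma> (\<pi> (Suc i)) x \<and> v (Suc i) x \<le> value_bound"
    if a: "admissible U f r \<gamma> (\<pi> i)" for i x
  proof -
    have "\<pi> i y \<in> U" for y using a by (auto simp: admissible_def policy_def)
    then show ?thesis
      using policy_iteration_step[OF a pol C1 bellman[OF _ a] boundary[OF a] improved] by blast
  qed
  \<comment> \<open>The boundary condition is granted only for admissible policies, so each round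
    must first inherit admissibility from the previous one.\<close>
  have adm: "admissible U f r \<gamma> (\<pi> i)" for i
    by (induction i) (use adm0 step in auto)
  obtain j where "i = Suc j" using \<open>1 \<le> i\<close> by (cases i) auto
  have "ereal (v (Suc j) x) \<le> VF f r \<gamma> (\<pi> (Suc j)) x"
    using step[OF adm, of j x] by blast
  also have "\<dots> = ereal (v (Suc (Suc j)) x)"
    by (rule sym) (use step[OF adm, of "Suc j" x] in blast)
  finally show "v i x \<le> v (Suc i) x"
    using \<open>i = Suc j\<close> by simp
  show "v i x \<le> value_bound"
    using step[OF adm, of j x] \<open>i = Suc j\<close> by blast
qed

end

section \<open>Convergence to the supremum\<close>

text \<open>Some continuous minorant \<open>w n\<close> already exceeds \<open>c\<close> at
  \<open>x\<close>, hence on a neighborhood, and the limit lies above it.\<close>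

lemma lower_semicontinuous_incseq_limit:
  assumes "\<And>n. continuous_on UNIV (w n)" "\<And>x. incseq (\<lambda>n. w n x)" "\<And>x. (\<lambda>n. w n x) \<longlonglongrightarrow> g x"
  shows "lower_semicontinuous g"
  unfolding lower_semicontinuous_def
proof (intro allI impI)
  fix x c assume "c < g x"
  then have "\<forall>\<^sub>F n in sequentially. c < w n x"
    using assms(3) order_tendstoD(1) by blast
  then obtain n where "c < w n x" by (auto simp: eventually_sequentially)
  moreover have "(w n \<longlongrightarrow> w n x) (nhds x)"
    using assms(1)[of n] by (simp add: continuous_on_def tendsto_at_iff_tendsto_nhds)
  ultimately have "\<forall>\<^sub>F y in nhds x. c < w n y"
    using order_tendstoD(1) by blast
  then show "\<forall>\<^sub>F y in nhds x. c < g y"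
    by (rule eventually_mono) (rule less_le_trans[OF _ incseq_le[OF assms(2,3)]])
qed

theorem theorem4p2:
  fixes U :: "(real ^ 'm) set"
    and f :: "real ^ 'l \<Rightarrow> real ^ 'm \<Rightarrow> real ^ 'l"
    and r :: "real ^ 'l \<Rightarrow> real ^ 'm \<Rightarrow> real"
    and \<gamma> :: real
    and \<eta> :: real
    and f\<^sub>d :: "real ^ 'l \<Rightarrow> real ^ 'l"
    and f\<^sub>c :: "real ^ 'l \<Rightarrow> real ^ 'm \<Rightarrow> real ^ 'l"
    and v :: "nat \<Rightarrow> real ^ 'l \<Rightarrow> real"
    and \<pi> :: "nat \<Rightarrow> real ^ 'l \<Rightarrow> real ^ 'm"
  assumes "rl_problem U f r \<gamma>"
    and "DPI U f r \<gamma> v \<pi> \<or> IPI U f r \<gamma> \<eta> f\<^sub>d f\<^sub>c v \<pi>"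
    and "boundary_condition U f r \<gamma> v \<pi>"
  shows "lower_semicontinuous (vhat v) \<and>
    (\<forall>x. (\<lambda>i. v i x) \<longlonglongrightarrow> vhat v x) \<and>
    (\<forall>\<Omega>. compact \<Omega> \<and> continuous_on \<Omega> (vhat v) \<longrightarrow> uniform_limit \<Omega> v (vhat v) sequentially) \<and>
    (continuous_on UNIV (vhat v) \<longrightarrow> locally_uniform_limit v (vhat v))"
proof -
  interpret rl_problem U f r \<gamma> by fact
  \<comment> \<open>As \<open>v 0\<close> is arbitrary, monotonicity holds from index 1 on; the
    shift makes it hold from 0.\<close>
  define w where "w n = v (Suc n)" for n
  have cont: "continuous_on S (w n)" for n S
    using policy_iteration_C1[OF assms(2), of "Suc n"] C1_continuous_on by (simp add: w_def)
  have inc: "incseq (\<lambda>n. w n x)" for x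
    using policy_iteration_monotone_bounded(1)[OF assms(2,3)] by (intro incseq_SucI) (simp add: w_def)
  have "bdd_above (range (\<lambda>n. w n x))" for x
    using policy_iteration_monotone_bounded(2)[OF assms(2,3)] by (intro bdd_aboveI2[where M = value_bound]) (simp add: w_def)
  then have "(\<lambda>n. w n x) \<longlonglongrightarrow> (SUP n. w n x)" for x
    by (rule LIMSEQ_incseq_SUP[OF _ inc])
  moreover have "(SUP n. w n x) = vhat v x" for x
  proof -
    have "{1..} = range Suc" by (simp add: atLeast_Suc_greaterThan greaterThan_0)
    then show ?thesis by (simp add: vhat_def w_def image_image)
  qed
  ultimately have lim: "(\<lambda>n. w n x) \<longlonglongrightarrow> vhat v x" for x by simp
  have pointwise: "(\<lambda>i. v i x) \<longlonglongrightarrow> vhat v x" for x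
    using lim[of x] unfolding w_def by (rule filterlim_sequentially_Suc[THEN iffD1])
  have uniform: "uniform_limit \<Omega> v (vhat v) sequentially"
    if "compact \<Omega>" "continuous_on \<Omega> (vhat v)" for \<Omega>
  proof -
    have "uniform_limit \<Omega> w (vhat v) sequentially"
      by (rule Dini_uniform_limit[OF that(1) cont that(2) inc lim])
    then have "uniform_limit \<Omega> (\<lambda>n. v (Suc n)) (vhat v) sequentially"
      by (simp only: w_def[abs_def])
    then show ?thesis by (rule filterlim_sequentially_Suc[THEN iffD1])
  qed
  have "locally_uniform_limit v (vhat v)" if c: "continuous_on UNIV (vhat v)"
    unfolding locally_uniform_limit_def
  proof
    fix x :: "real ^ 'l"
    \<comment> \<open>The closed unit ball is compact in finite dimension, and the open ball inside
      it is the required neighborhood.\<close>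
    have "uniform_limit (ball x 1) v (vhat v) sequentially"
      by (rule uniform_limit_on_subset[OF uniform[of "cball x 1"]])
         (auto intro: continuous_on_subset[OF c])
    then show "\<exists>N. open N \<and> x \<in> N \<and> uniform_limit N v (vhat v) sequentially"
      by (intro exI[of _ "ball x 1"]) simp
  qed
  then show ?thesis
    using lower_semicontinuous_incseq_limit[where w = w, OF cont inc lim] pointwise uniform by blast
qed

end
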